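(* For all integers $n \ge 18$, we have $2n-24 \le c_\infty(C_n \,\Box\, C_n) \le 2n$, where $C_n$ is the cycle on $n$ vertices.
   Context: The infinite-speed game of Cops and Robbers on a finite graph $G$: there is a team of cops and one robber, each occupying a vertex of $G$ (several cops may share a vertex), with all positions known to both players. The cops first choose their initial positions; then the robber chooses his initial position. The game proceeds in rounds, each consisting of a cop turn followed by a robber turn. On the cops' turn, each cop either stays at her vertex or moves to a neighboring vertex. On the robber's turn, he may stay put or move along any path in $G$ of arbitrary length starting at his current vertex that does not pass through any vertex occupied by a cop. The cops win if at some point some cop occupies the same vertex as the robber; the robber wins if he evades capture forever. The infinite-speed cop number $c_\infty(G)$ is the minimum number of cops that guarantees a win for the cops on $G$ no matter how the robber plays. $\Box$ denotes the Cartesian product of graphs. *)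

theory Defs
  imports "Graph_Theory.Graph_Theory"
begin

text \<open>
  Finite simple graphs are represented by the locale \<^locale>\<open>pair_graph\<close>: an undirected
  edge is a pair of opposite arcs.
\<close>

text \<open>This is the cycle only for \<open>n \<ge> 3\<close>; for \<open>n = 1\<close> there is a loop.\<close>

definition cycle_graph :: "nat \<Rightarrow> nat pair_pre_digraph" where
  "cycle_graph n = \<lparr> pverts = {0..<n},
     parcs = {(i, j). i < n \<and> j < n \<and> (j = Suc i mod n \<or> i = Suc j mod n)} \<rparr>"

definition cartesian_product ::
  "'a pair_pre_digraph \<Rightarrow> 'b pair_pre_digraph \<Rightarrow> ('a \<times> 'b) pair_pre_digraph"  (infixr \<open>\<box>\<close> 80)
  where
  "G \<box> H = \<lparr> pverts = pverts G \<times> pverts H,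
     parcs = {((a, b), (c, d)).
       (a = c \<and> a \<in> pverts G \<and> (b, d) \<in> parcs H) \<or>
       (b = d \<and> b \<in> pverts H \<and> (a, c) \<in> parcs G)} \<rparr>"

lemma pair_graph_cycle_graph:
  assumes "n \<ge> 3"
  shows "pair_graph (cycle_graph n)"
proof -
  have "parcs (cycle_graph n) \<subseteq> {0..<n} \<times> {0..<n}"
    by (auto simp: cycle_graph_def)
  then have "finite (parcs (cycle_graph n))"
    by (rule finite_subset) simp
  then show ?thesis
    using assms
    by unfold_locales
      (auto simp: cycle_graph_def mod_Suc symmetric_def sym_def split: if_splits)
qed

lemma pair_graph_cartesian_product:
  assumes "pair_graph G" "pair_graph H"
  shows "pair_graph (G \<box> H)"
proof -
  interpret G: pair_graph G by fact
  interpret H: pair_graph H by fact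
  have sub: "parcs (G \<box> H) \<subseteq> (pverts G \<times> pverts H) \<times> (pverts G \<times> pverts H)"
    by (auto simp: cartesian_product_def dest: G.wellformed' H.wellformed')
  have fin: "finite (pverts (G \<box> H))"
    by (simp add: cartesian_product_def G.pair_finite_verts H.pair_finite_verts)
  have "finite (parcs (G \<box> H))"
    by (rule finite_subset[OF sub]) (simp add: G.pair_finite_verts H.pair_finite_verts)
  moreover have "symmetric (with_proj (G \<box> H))"
    using G.pair_sym_arcs H.pair_sym_arcs
    by (auto simp: symmetric_def sym_def cartesian_product_def)
  ultimately show ?thesis
    using fin
    by unfold_locales
      (auto simp: cartesian_product_def dest: G.wellformed' H.wellformed'
        G.pair_no_loops H.pair_no_loops)
qed

text \<open>
  A cop configuration is a list whose \<open>i\<close>-th entry is the position of the \<open>i\<close>-th cop, so that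
  several cops may share a vertex.
\<close>

definition cop_move :: "'v pair_pre_digraph \<Rightarrow> 'v list \<Rightarrow> 'v list \<Rightarrow> bool" where
  "cop_move G C D \<longleftrightarrow> list_all2 (\<lambda>u v. u = v \<or> (u, v) \<in> parcs G) C D"

definition robber_move :: "'v pair_pre_digraph \<Rightarrow> 'v list \<Rightarrow> 'v \<Rightarrow> 'v \<Rightarrow> bool" where
  "robber_move G C u v \<longleftrightarrow>
     u = v \<or> (\<exists>p. vpath p (with_proj G) \<and> hd p = u \<and> last p = v \<and> set p \<inter> set C = {})"

text \<open>
  A strategy of \<open>k\<close> cops maps the list of all past positions of the robber to the current cop
  configuration: \<open>S []\<close> is the initial one, and \<open>S [r\<^sub>0, \<dots>, r\<^sub>i]\<close> is the one after the cop turn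
  that follows the robber's choice of \<open>r\<^sub>i\<close>.  The past configurations of the cops are
  determined by \<open>S\<close> itself, so they need not be arguments.
\<close>

definition cop_strategy :: "'v pair_pre_digraph \<Rightarrow> nat \<Rightarrow> ('v list \<Rightarrow> 'v list) \<Rightarrow> bool" where
  "cop_strategy G k S \<longleftrightarrow>
     (\<forall>h. set h \<subseteq> pverts G \<longrightarrow> length (S h) = k \<and> set (S h) \<subseteq> pverts G) \<and>
     (\<forall>h r. set h \<subseteq> pverts G \<and> r \<in> pverts G \<longrightarrow> cop_move G (S h) (S (h @ [r])))"

text \<open>
  Plays are infinite; a play that has been decided by a capture simply goes on, since staying put
  is always possible, and what happens afterwards is irrelevant.
\<close>

definition robber_play :: "'v pair_pre_digraph \<Rightarrow> ('v list \<Rightarrow> 'v list) \<Rightarrow> (nat \<Rightarrow> 'v) \<Rightarrow> bool" where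
  "robber_play G S r \<longleftrightarrow>
     (\<forall>i. r i \<in> pverts G) \<and>
     (\<forall>i. robber_move G (S (map r [0..<Suc i])) (r i) (r (Suc i)))"

text \<open>The two disjuncts are capture before and capture after the \<open>i\<close>-th cop turn.\<close>

definition captured :: "('v list \<Rightarrow> 'v list) \<Rightarrow> (nat \<Rightarrow> 'v) \<Rightarrow> bool" where
  "captured S r \<longleftrightarrow>
     (\<exists>i. r i \<in> set (S (map r [0..<i])) \<or> r i \<in> set (S (map r [0..<Suc i])))"

definition cops_win :: "'v pair_pre_digraph \<Rightarrow> nat \<Rightarrow> bool" where
  "cops_win G k \<longleftrightarrow>
     (\<exists>S. cop_strategy G k S \<and> (\<forall>r. robber_play G S r \<longrightarrow> captured S r))"

definition cop_number_infinity :: "'v pair_pre_digraph \<Rightarrow> nat"  (\<open>c\<^sub>\<infinity>\<close>) where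
  "c\<^sub>\<infinity> G = (LEAST k. cops_win G k)"

text \<open>On a finite graph the minimum is attained: one cop on every vertex is enough.\<close>

lemma cops_win_card_verts:
  assumes "finite (pverts G)"
  shows "cops_win G (card (pverts G))"
proof -
  obtain C where C: "set C = pverts G" "distinct C"
    using finite_distinct_list[OF assms] by blast
  have "cop_strategy G (card (pverts G)) (\<lambda>_. C)"
    using C by (auto simp: cop_strategy_def cop_move_def distinct_card[symmetric] list.rel_refl)
  moreover have "captured (\<lambda>_. C) r" if "robber_play G (\<lambda>_. C) r" for r
    using that C by (auto simp: robber_play_def captured_def)
  ultimately show ?thesis
    unfolding cops_win_def by blast
qed

lemma cops_win_cop_number_infinity:
  assumes "finite (pverts G)"
  shows "cops_win G (c\<^sub>\<infinity> G)"
  unfolding cop_number_infinity_def by (rule LeastI) (rule cops_win_card_verts[OF assms])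

end

theory Submission
  imports Defs
begin

text \<open>
  The upper bound: \<open>2n\<close> cops fill row \<open>0\<close> twice.  One copy stays, the other one advances by a
  row in every round.  The robber, however fast, cannot pass a full row, so the rows left to him
  run out.

  The lower bound: let there be at most \<open>2n - 25\<close> cops.  Call a row or column \<^emph>\<open>light\<close> if it
  contains at most one cop.  A light line remains connected when its cop is removed, and by
  counting there are at least three light rows and three light columns; as rows meet columns,
  all unoccupied vertices on light lines lie in one component of the graph without the cops
  (\<open>linked_if_on_light_lines\<close>).  This is the component in which the robber wants to be.  The
  difficulty is that he chooses his vertex before the cops move.  So he looks for a \<^emph>\<open>haven\<close>, a
  vertex that after every possible cop turn is unoccupied and still belongs to that component.
  If there is always a haven, he goes from one to the next forever.

  That there is a haven (\<open>haven_exists\<close>) is the heart of the proof.  Suppose that no vertex of row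
  \<open>t\<close> is one, and take an interval of columns in which no cop can enter row \<open>t\<close> with her next
  move.  That piece of row \<open>t\<close> stays connected whatever the cops do.  Since it contains no haven,
  some cop turn cuts all of it off from the light lines; after this turn every column of the
  interval contains at least two cops.  Before the turn these cops were in the interval enlarged
  by one column at each end.  So there are two cops per column, except for a bounded loss at each
  cop who is already close to row \<open>t\<close> and separates two such intervals.  Summing over the
  intervals shows that \<open>2n\<close> exceeds the number of cops by at most \<open>5\<close> for every cop in row
  \<open>t\<close> and \<open>4\<close> for every cop in the two neighboring rows.  This excess is at least \<open>25\<close>.  If this holds for every row \<open>t\<close>, then the
  resulting system of inequalities forces an average of two cops per row, which is impossible.
\<close>

section \<open>Moves on the torus\<close>

abbreviation torus :: "nat \<Rightarrow> (nat \<times> nat) pair_pre_digraph" where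
  "torus n \<equiv> cycle_graph n \<box> cycle_graph n"

lemma pverts_torus: "pverts (torus n) = {0..<n} \<times> {0..<n}"
  by (simp add: cartesian_product_def cycle_graph_def)

lemma parcs_torus:
  "((a, b), (c, d)) \<in> parcs (torus n) \<longleftrightarrow> a < n \<and> b < n \<and> c < n \<and> d < n \<and>
     (a = c \<and> (d = Suc b mod n \<or> b = Suc d mod n) \<or>
      b = d \<and> (c = Suc a mod n \<or> a = Suc c mod n))"
  by (auto simp: cartesian_product_def cycle_graph_def)

lemma eq_mod_if_Suc_mod_eq:
  fixes a n t :: nat
  assumes "a < n" "Suc a mod n = Suc t mod n"
  shows "a = t mod n"
proof -
  define s where "s = t mod n"
  have "s < n" using assms(1) by (simp add: s_def)
  moreover have "Suc t mod n = (if Suc s = n then 0 else Suc s)"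
    unfolding s_def by (rule mod_Suc)
  moreover have "Suc a mod n = (if Suc a = n then 0 else Suc a)"
    using assms(1) by (simp add: mod_Suc)
  ultimately show ?thesis
    unfolding s_def[symmetric] using assms by (simp split: if_splits)
qed

text \<open>
  Excluding the occupied vertices at both ends of a step makes the relation symmetric.  Its
  reflexive transitive closure relates every vertex to itself, even an occupied one.
\<close>

definition free_step :: "nat \<Rightarrow> (nat \<times> nat) list \<Rightarrow> nat \<times> nat \<Rightarrow> nat \<times> nat \<Rightarrow> bool" where
  "free_step n D u v \<longleftrightarrow> (u, v) \<in> parcs (torus n) \<and> u \<notin> set D \<and> v \<notin> set D"

abbreviation linked :: "nat \<Rightarrow> (nat \<times> nat) list \<Rightarrow> nat \<times> nat \<Rightarrow> nat \<times> nat \<Rightarrow> bool" where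
  "linked n D \<equiv> (free_step n D)\<^sup>*\<^sup>*"

lemma linked_sym: "linked n D u v \<Longrightarrow> linked n D v u"
proof (induction rule: rtranclp_induct)
  case (step v w)
  then have "free_step n D w v"
    by (cases v, cases w) (auto simp: free_step_def parcs_torus)
  with step.IH show ?case by (meson converse_rtranclp_into_rtranclp)
qed simp

lemma robber_move_if_linked:
  assumes "linked n D u v"
  shows "robber_move (torus n) D u v"
proof -
  have "u = v \<or> (\<exists>p. vwalk p (with_proj (torus n)) \<and> hd p = u \<and> last p = v \<and> set p \<inter> set D = {})"
    using assms
  proof (induction rule: converse_rtranclp_induct)
    case (step u w)
    obtain a b c d where uw: "u = (a, b)" "w = (c, d)" by (cases u, cases w)
    have arc: "(u, w) \<in> parcs (torus n)" "u \<notin> set D" "w \<notin> set D"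
      using step.hyps by (auto simp: free_step_def)
    then have inV: "u \<in> pverts (torus n)" "w \<in> pverts (torus n)"
      by (auto simp: uw parcs_torus pverts_torus)
    have ends: "(u, w) \<in> arcs_ends (with_proj (torus n))"
      using arc by (auto simp: arcs_ends_def arc_to_ends_def)
    obtain p where p: "vwalk p (with_proj (torus n))" "hd p = w" "last p = v" "set p \<inter> set D = {}"
    proof (cases "w = v")
      case True
      show ?thesis
        by (rule that[of "[w]"]) (use True arc inV in \<open>auto simp: vwalk_def\<close>)
    next
      case False
      then show ?thesis using step.IH that by blast
    qed
    from p(1) have "p \<noteq> []" by (simp add: vwalk_def)
    with p ends inV arc have "vwalk (u # p) (with_proj (torus n))"
      by (cases p) (auto simp: vwalk_def)
    with p \<open>p \<noteq> []\<close> arc show ?case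
      by (intro disjI2 exI[of _ "u # p"]) auto
  qed simp
  then show ?thesis
  proof
    assume "\<exists>p. vwalk p (with_proj (torus n)) \<and> hd p = u \<and> last p = v \<and> set p \<inter> set D = {}"
    then obtain p where p: "vwalk p (with_proj (torus n))" "hd p = u" "last p = v" "set p \<inter> set D = {}"
      by blast
    have "vpath (vwalk_to_vpath p) (with_proj (torus n))"
      using p(1) by (rule vwalk_to_vpath_vpath)
    moreover have "set (vwalk_to_vpath p) \<inter> set D = {}"
      using p(4) vwalk_to_vpath_subset[of _ p] by blast
    ultimately show ?thesis
      using p by (auto simp: robber_move_def vwalk_to_vpath_hd vwalk_to_vpath_last
          intro!: exI[of _ "vwalk_to_vpath p"])
  qed (simp add: robber_move_def)
qed

lemma cop_comes_from:
  assumes "cop_move G C D" "d \<in> set D"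
  shows "\<exists>c \<in> set C. c = d \<or> (c, d) \<in> parcs G"
  using assms unfolding cop_move_def
  by (induction rule: list_all2_induct) auto

text \<open>
  A cop enters a vertex of row \<open>t + 1\<close> vertically from the same column or horizontally along the
  row.  The vertex has successors as coordinates so that no subtraction modulo \<open>n\<close> occurs; this
  indexing is kept below.
\<close>

lemma not_occupied_next:
  assumes "cop_move (torus n) C D"
    and "\<And>y. y \<in> {x, Suc x, Suc (Suc x)} \<Longrightarrow> (Suc t mod n, y mod n) \<notin> set C"
    and "(t mod n, Suc x mod n) \<notin> set C" "(Suc (Suc t) mod n, Suc x mod n) \<notin> set C"
  shows "(Suc t mod n, Suc x mod n) \<notin> set D"
proof
  assume "(Suc t mod n, Suc x mod n) \<in> set D"
  then obtain a b where ab: "(a, b) \<in> set C"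
    "(a, b) = (Suc t mod n, Suc x mod n) \<or> ((a, b), (Suc t mod n, Suc x mod n)) \<in> parcs (torus n)"
    using cop_comes_from[OF assms(1)] by fast
  have up: "Suc (Suc y mod n) mod n = Suc (Suc y) mod n" for y
    by (rule mod_Suc_eq)
  have down: "Suc y mod n = Suc b mod n \<Longrightarrow> b < n \<Longrightarrow> b = y mod n" for b y
    by (rule eq_mod_if_Suc_mod_eq) auto
  have "(a, b) = (Suc t mod n, Suc x mod n)
      \<or> a = Suc t mod n \<and> (b = x mod n \<or> b = Suc (Suc x) mod n)
      \<or> b = Suc x mod n \<and> (a = t mod n \<or> a = Suc (Suc t) mod n)"
    using ab(2) unfolding parcs_torus up by (auto dest: down)
  then show False
    using ab(1) assms(2)[of x] assms(2)[of "Suc x"] assms(2)[of "Suc (Suc x)"] assms(3,4)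
    by (elim disjE conjE) simp_all
qed

section \<open>Counting cops on rows and columns\<close>

text \<open>
  With \<open>f\<close> the first or second projection this counts the cops, with multiplicity, in a row or in
  a column.  The index is read modulo \<open>n\<close>, so that intervals may run around the torus.
\<close>

definition line_count :: "nat \<Rightarrow> ('v \<Rightarrow> nat) \<Rightarrow> 'v list \<Rightarrow> nat \<Rightarrow> nat" where
  "line_count n f D x = length (filter (\<lambda>v. f v = x mod n) D)"

lemma line_count_Nil [simp]: "line_count n f [] x = 0"
  and line_count_Cons [simp]:
    "line_count n f (d # D) x = of_bool (f d = x mod n) + line_count n f D x"
  by (simp_all add: line_count_def)

lemma line_count_pos: "v \<in> set D \<Longrightarrow> f v = x mod n \<Longrightarrow> line_count n f D x \<ge> 1"
  by (auto simp: line_count_def Suc_le_eq filter_empty_conv)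

lemma sum_period:
  fixes f :: "nat \<Rightarrow> nat"
  assumes "\<And>x. f (x + n) = f x"
  shows "sum f {m..<m + n} = sum f {0..<n}"
proof (induction m)
  case (Suc m)
  have "sum f {Suc m..<Suc m + n} + f m = sum f {m..<m + n} + f (m + n)"
    using sum.atLeast_Suc_lessThan[of m "Suc m + n" f]
    by (simp add: add.commute)
  then show ?case using Suc assms[of m] by simp
qed simp

lemma sum_line_count:
  assumes "\<forall>v \<in> set D. f v < n"
  shows "(\<Sum>x = m..<m + n. line_count n f D x) = length D"
proof -
  have "(\<Sum>x = 0..<n. line_count n f D x) = length D"
    using assms
  proof (induction D)
    case (Cons d D)
    have "(\<Sum>x = 0..<n. of_bool (f d = x mod n)) = (\<Sum>x = 0..<n. if f d = x then 1 else (0::nat))"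
      by (rule sum.cong) auto
    also have "\<dots> = 1" using Cons.prems by simp
    finally show ?case using Cons by (simp add: sum.distrib)
  qed simp
  then show ?thesis
    by (subst sum_period) (auto simp: line_count_def)
qed

text \<open>
  A move changes the column by at most one, so the cops in an interval of columns come from the
  interval enlarged by one column at each end.  If the enlarged interval is longer than a full
  turn, columns are counted repeatedly.  The inequality still holds, because it holds for each
  cop: to every occurrence of her new column belongs an adjacent occurrence of her old one.
\<close>

lemma sum_col_count_move:
  assumes "cop_move (torus n) C D"
  shows "(\<Sum>x = Suc u..<Suc v. line_count n snd D x) \<le> (\<Sum>x = u..<v + 2. line_count n snd C x)"
  using assms unfolding cop_move_def
proof (induction rule: list_all2_induct)
  case (Cons c C d D)
  let ?g = "\<lambda>y x. of_bool (y = x mod n) :: nat"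
  \<comment> \<open>The shift \<open>e\<close> depends on the cop only: \<open>0\<close>, \<open>1\<close>, \<open>2\<close> for a move up, none, and down.\<close>
  have shift: "\<exists>e \<le> 2. \<forall>x. ?g (snd d) (Suc x) \<le> ?g (snd c) (x + e)"
  proof -
    obtain c1 c2 d1 d2 where cd: "c = (c1, c2)" "d = (d1, d2)" by (cases c, cases d)
    from Cons.hyps(1) consider "c2 = d2" | "c2 < n" "d2 = Suc c2 mod n" | "c2 = Suc d2 mod n"
      unfolding cd by (auto simp: parcs_torus)
    then show ?thesis
    proof cases
      case 1 then show ?thesis by (intro exI[of _ 1]) (auto simp: cd)
    next
      case 2
      then show ?thesis
        by (intro exI[of _ 0]) (auto simp: cd dest: eq_mod_if_Suc_mod_eq)
    next
      case 3 then show ?thesis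
        by (intro exI[of _ 2]) (auto simp: cd mod_Suc_eq)
    qed
  qed
  then obtain e where e: "e \<le> 2" "\<And>x. ?g (snd d) (Suc x) \<le> ?g (snd c) (x + e)" by blast
  have "(\<Sum>x = Suc u..<Suc v. ?g (snd d) x) = (\<Sum>x = u..<v. ?g (snd d) (Suc x))"
    by (rule sum.shift_bounds_Suc_ivl)
  also have "\<dots> \<le> (\<Sum>x = u..<v. ?g (snd c) (x + e))"
    by (intro sum_mono e)
  also have "\<dots> = (\<Sum>x = u + e..<v + e. ?g (snd c) x)"
    by (rule sum.shift_bounds_nat_ivl[symmetric])
  also have "\<dots> \<le> (\<Sum>x = u..<v + 2. ?g (snd c) x)"
    using e(1) by (intro sum_mono2) auto
  finally have *: "(\<Sum>x = Suc u..<Suc v. ?g (snd d) x) \<le> (\<Sum>x = u..<v + 2. ?g (snd c) x)" .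
  show ?case
    unfolding line_count_Cons sum.distrib by (rule add_mono[OF * Cons.IH])
qed simp

section \<open>Light lines\<close>

definition on_light_line :: "nat \<Rightarrow> (nat \<times> nat) list \<Rightarrow> nat \<times> nat \<Rightarrow> bool" where
  "on_light_line n D v \<longleftrightarrow> line_count n fst D (fst v) \<le> 1 \<or> line_count n snd D (snd v) \<le> 1"

lemma linked_along_walk:
  assumes "\<And>x. (w x, w (Suc x)) \<in> parcs (torus n)"
    and "u \<le> v" "\<And>x. u \<le> x \<Longrightarrow> x \<le> v \<Longrightarrow> w x \<notin> set D"
  shows "linked n D (w u) (w v)"
  using assms(2,3)
proof (induction v rule: dec_induct)
  case (step v)
  then have "free_step n D (w v) (w (Suc v))"
    using assms(1) by (auto simp: free_step_def)
  moreover have "linked n D (w u) (w v)"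
    using step by auto
  ultimately show ?case by simp
qed simp

text \<open>
  Of the two arcs of a cycle between two vertices, a single obstacle blocks only one.
\<close>

lemma linked_on_light_cycle:
  assumes arc: "\<And>x. (w x, w (Suc x)) \<in> parcs (torus n)"
    and per: "\<And>x. w (x + n) = w x"
    and uniq: "\<And>x y. x < n \<Longrightarrow> y < n \<Longrightarrow> w x \<in> set D \<Longrightarrow> w y \<in> set D \<Longrightarrow> x = y"
    and xy: "x < n" "y < n" "w x \<notin> set D" "w y \<notin> set D"
  shows "linked n D (w x) (w y)"
proof -
  have main: "linked n D (w x) (w y)"
    if xy: "x \<le> y" "y < n" "w x \<notin> set D" "w y \<notin> set D" for x y
  proof (cases "\<exists>z. x \<le> z \<and> z \<le> y \<and> w z \<in> set D")
    case False
    then show ?thesis using xy(1) by (intro linked_along_walk arc) auto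
  next
    case True
    then obtain z where z: "x \<le> z" "z \<le> y" "w z \<in> set D" by blast
    have "w i \<notin> set D" if i: "y \<le> i" "i \<le> x + n" for i
    proof
      assume "w i \<in> set D"
      show False
      proof (cases "i < n")
        case True
        with uniq[of i z] z xy \<open>w i \<in> set D\<close> i show False by auto
      next
        case False
        with per[of "i - n"] \<open>w i \<in> set D\<close> have "w (i - n) \<in> set D" by simp
        with uniq[of "i - n" z] z xy i False have "i - n = z" by auto
        with i z False have "z = x" by auto
        with z xy show False by auto
      qed
    qed
    then have "linked n D (w y) (w (x + n))"
      using xy by (intro linked_along_walk arc) auto
    then show ?thesis using per[of x] linked_sym by metis
  qed
  show ?thesis
    using main[of x y] main[of y x] xy linked_sym by (metis nat_le_linear)
qed

lemma line_count_le_1_unique: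
  assumes "line_count n f D x \<le> 1" "u \<in> set D" "v \<in> set D" "f u = x mod n" "f v = x mod n"
  shows "u = v"
proof (rule ccontr)
  assume "u \<noteq> v"
  have "{u, v} \<subseteq> set (filter (\<lambda>v. f v = x mod n) D)" using assms by auto
  then have "card {u, v} \<le> card (set (filter (\<lambda>v. f v = x mod n) D))"
    by (intro card_mono) auto
  also have "\<dots> \<le> line_count n f D x"
    unfolding line_count_def by (rule card_length)
  finally show False using \<open>u \<noteq> v\<close> assms(1) by simp
qed

lemma linked_on_light_row:
  assumes "t < n" "line_count n fst D t \<le> 1" "x < n" "y < n" "(t, x) \<notin> set D" "(t, y) \<notin> set D"
  shows "linked n D (t, x) (t, y)"
proof -
  have "linked n D (t, x mod n) (t, y mod n)"
  proof (rule linked_on_light_cycle[where w = "\<lambda>x. (t, x mod n)" and n = n])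
    show "((t, x mod n), (t, Suc x mod n)) \<in> parcs (torus n)" for x
      using assms(1) by (auto simp: parcs_torus mod_Suc_eq)
  next
    fix x y assume "x < n" "y < n" "(t, x mod n) \<in> set D" "(t, y mod n) \<in> set D"
    then show "x = y"
      using line_count_le_1_unique[OF assms(2), of "(t, x)" "(t, y)"] assms(1) by auto
  qed (use assms in auto)
  then show ?thesis using assms by simp
qed

lemma linked_on_light_column:
  assumes "t < n" "line_count n snd D t \<le> 1" "x < n" "y < n" "(x, t) \<notin> set D" "(y, t) \<notin> set D"
  shows "linked n D (x, t) (y, t)"
proof -
  have "linked n D (x mod n, t) (y mod n, t)"
  proof (rule linked_on_light_cycle[where w = "\<lambda>x. (x mod n, t)" and n = n])
    show "((x mod n, t), (Suc x mod n, t)) \<in> parcs (torus n)" for x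
      using assms(1) by (auto simp: parcs_torus mod_Suc_eq)
  next
    fix x y assume "x < n" "y < n" "(x mod n, t) \<in> set D" "(y mod n, t) \<in> set D"
    then show "x = y"
      using line_count_le_1_unique[OF assms(2), of "(x, t)" "(y, t)"] assms(1) by auto
  qed (use assms in auto)
  then show ?thesis using assms by simp
qed

text \<open>
  With at most two light lines, the other \<open>n - 2\<close> parallel ones would contain at least \<open>2n - 4\<close>
  cops.
\<close>

lemma three_light_lines:
  assumes "\<forall>v \<in> set D. f v < n" "length D + 5 \<le> 2 * n"
  shows "card {x. x < n \<and> line_count n f D x \<le> 1} \<ge> 3"
proof (rule ccontr)
  let ?L = "{x. x < n \<and> line_count n f D x \<le> 1}"
  assume "\<not> card ?L \<ge> 3"
  then have L: "card ?L \<le> 2" by simp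
  have "card ({0..<n} - ?L) = n - card ?L"
    by (subst card_Diff_subset) auto
  then have "2 * (n - 2) \<le> (\<Sum>x\<in>{0..<n} - ?L. 2)"
    using L by simp
  also have "\<dots> \<le> (\<Sum>x\<in>{0..<n} - ?L. line_count n f D x)"
    by (rule sum_mono) auto
  also have "\<dots> \<le> (\<Sum>x = 0..<n. line_count n f D x)"
    by (rule sum_mono2) auto
  also have "\<dots> = length D"
    using sum_line_count[OF assms(1), of 0] by simp
  finally show False using assms(2) by simp
qed

lemma light_line_avoiding:
  assumes "\<forall>v \<in> set D. f v < n" "length D + 5 \<le> 2 * n"
  obtains x where "x < n" "line_count n f D x \<le> 1" "x \<noteq> y" "x \<noteq> z"
proof -
  have "\<not> {x. x < n \<and> line_count n f D x \<le> 1} \<subseteq> {y, z}"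
  proof
    assume "{x. x < n \<and> line_count n f D x \<le> 1} \<subseteq> {y, z}"
    then have "card {x. x < n \<and> line_count n f D x \<le> 1} \<le> card {y, z}"
      by (intro card_mono) auto
    also have "\<dots> \<le> 2" by (simp add: card_insert_if)
    finally show False using three_light_lines[OF assms] by simp
  qed
  then show thesis using that by blast
qed

lemma light_row_gap:
  assumes "t < n" "line_count n fst D t \<le> 1"
  obtains z where "\<forall>x. x \<noteq> z \<longrightarrow> (t, x) \<notin> set D"
  using line_count_le_1_unique[OF assms(2)] assms(1)
  by (metis fst_conv mod_less old.prod.inject)

lemma light_column_gap:
  assumes "t < n" "line_count n snd D t \<le> 1"
  obtains z where "\<forall>x. x \<noteq> z \<longrightarrow> (x, t) \<notin> set D"
  using line_count_le_1_unique[OF assms(2)] assms(1)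
  by (metis snd_conv mod_less old.prod.inject)

text \<open>
  From a light column one gets to a light row, along the column and past its only cop.  Two light
  rows are connected through a light column that meets neither row in its cop; among three light
  columns there is one.
\<close>

lemma linked_if_on_light_lines:
  assumes D: "set D \<subseteq> pverts (torus n)" "length D + 5 \<le> 2 * n"
    and u: "u \<in> pverts (torus n)" "u \<notin> set D" "on_light_line n D u"
    and v: "v \<in> pverts (torus n)" "v \<notin> set D" "on_light_line n D v"
  shows "linked n D u v"
proof -
  have fD: "\<forall>v \<in> set D. fst v < n" and sD: "\<forall>v \<in> set D. snd v < n"
    using D(1) by (auto simp: pverts_torus)
  have to_row: "\<exists>t x. t < n \<and> x < n \<and> line_count n fst D t \<le> 1 \<and> (t, x) \<notin> set D \<and> linked n D u (t, x)"
    if u: "u \<in> pverts (torus n)" "u \<notin> set D" "on_light_line n D u" for u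
  proof (cases "line_count n fst D (fst u) \<le> 1")
    case True
    with u show ?thesis
      by (intro exI[of _ "fst u"] exI[of _ "snd u"]) (auto simp: pverts_torus)
  next
    case False
    obtain a b where ab: "u = (a, b)" "a < n" "b < n" using u(1) by (auto simp: pverts_torus)
    have b: "line_count n snd D b \<le> 1" using False u(3) by (simp add: on_light_line_def ab)
    obtain z where z: "\<forall>x. x \<noteq> z \<longrightarrow> (x, b) \<notin> set D" using light_column_gap[OF ab(3) b] .
    obtain t where t: "t < n" "line_count n fst D t \<le> 1" "t \<noteq> z"
      using light_line_avoiding[OF fD D(2)] by metis
    have "linked n D (a, b) (t, b)"
      using z t ab u(2) b by (intro linked_on_light_column) auto
    then show ?thesis using t z ab by blast
  qed
  obtain s x where s: "s < n" "x < n" "line_count n fst D s \<le> 1" "(s, x) \<notin> set D" "linked n D u (s, x)"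
    using to_row[OF u] by blast
  obtain t y where t: "t < n" "y < n" "line_count n fst D t \<le> 1" "(t, y) \<notin> set D" "linked n D v (t, y)"
    using to_row[OF v] by blast
  obtain z1 where z1: "\<forall>x. x \<noteq> z1 \<longrightarrow> (s, x) \<notin> set D" using light_row_gap[OF s(1,3)] .
  obtain z2 where z2: "\<forall>x. x \<noteq> z2 \<longrightarrow> (t, x) \<notin> set D" using light_row_gap[OF t(1,3)] .
  obtain c where c: "c < n" "line_count n snd D c \<le> 1" "c \<noteq> z1" "c \<noteq> z2"
    using light_line_avoiding[OF sD D(2)] .
  have "linked n D (s, x) (s, c)" using s c z1 by (intro linked_on_light_row) auto
  moreover have "linked n D (s, c) (t, c)" using s t c z1 z2 by (intro linked_on_light_column) auto
  moreover have "linked n D (t, c) (t, y)" using t c z2 by (intro linked_on_light_row) auto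
  ultimately show ?thesis using s(5) linked_sym[OF t(5)] by (meson rtranclp_trans)
qed

section \<open>Positions that no cop move can cut off\<close>

text \<open>
  Staying put is a possible cop turn, so a haven is in particular unoccupied and connected to the
  light lines at present.
\<close>

definition haven :: "nat \<Rightarrow> (nat \<times> nat) list \<Rightarrow> nat \<times> nat \<Rightarrow> bool" where
  "haven n C r \<longleftrightarrow> r \<in> pverts (torus n) \<and>
     (\<forall>D. cop_move (torus n) C D \<longrightarrow> r \<notin> set D \<and>
       (\<exists>s \<in> pverts (torus n). s \<notin> set D \<and> on_light_line n D s \<and> linked n D r s))"

lemma cop_move_pverts:
  assumes "cop_move (torus n) C D" "set C \<subseteq> pverts (torus n)"
  shows "set D \<subseteq> pverts (torus n)"
proof
  fix d assume "d \<in> set D"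
  then obtain c where "c \<in> set C" and step: "c = d \<or> (c, d) \<in> parcs (torus n)"
    using cop_comes_from[OF assms(1)] by blast
  then have "c \<in> pverts (torus n)" using assms(2) by blast
  with step show "d \<in> pverts (torus n)"
    by (cases c; cases d) (auto simp: parcs_torus pverts_torus)
qed

lemma line_count_mod [simp]: "line_count n f D (x mod n) = line_count n f D x"
  by (simp add: line_count_def)

text \<open>
  The columns \<open>u + 1, \<dots>, v\<close> of row \<open>t + 1\<close> stay connected in every turn.  So the turn that
  cuts off the first of these vertices from the light lines cuts off all of them, and puts at
  least two cops into each of their columns.
\<close>

lemma cops_facing_unreachable_interval:
  assumes n: "n > 0"
    and no_haven: "\<And>x. \<not> haven n C (Suc t mod n, x mod n)"
    and unreachable: "\<And>x D. u \<le> x \<Longrightarrow> x < v \<Longrightarrow> cop_move (torus n) C D \<Longrightarrow>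
        (Suc t mod n, Suc x mod n) \<notin> set D"
  shows "2 * (v - u) \<le> (\<Sum>x = u..<v + 2. line_count n snd C x)"
proof (cases "u < v")
  case True
  define w where "w x = (Suc t mod n, x mod n)" for x
  have w: "w x \<in> pverts (torus n)" for x using n by (simp add: w_def pverts_torus)
  have "\<not> haven n C (w (Suc u))" using no_haven by (simp add: w_def)
  then obtain D where D: "cop_move (torus n) C D"
    and cut: "w (Suc u) \<notin> set D \<Longrightarrow>
      \<not> (\<exists>s \<in> pverts (torus n). s \<notin> set D \<and> on_light_line n D s \<and> linked n D (w (Suc u)) s)"
    using w unfolding haven_def by blast
  have free: "w (Suc x) \<notin> set D" if "u \<le> x" "x < v" for x
    using unreachable[OF that D] by (simp add: w_def)
  have heavy: "2 \<le> line_count n snd D (Suc x)" if x: "u \<le> x" "x < v" for x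
  proof -
    have "linked n D (w (Suc u)) (w (Suc x))"
    proof (rule linked_along_walk)
      show "(w x, w (Suc x)) \<in> parcs (torus n)" for x
        using n by (auto simp: w_def parcs_torus mod_Suc_eq)
      show "w y \<notin> set D" if "Suc u \<le> y" "y \<le> Suc x" for y
        using free[of "y - 1"] that x by auto
    qed (use x in auto)
    then have "\<not> on_light_line n D (w (Suc x))"
      using cut free[OF x] free[of u] True w by blast
    then show ?thesis by (auto simp: on_light_line_def w_def)
  qed
  have "2 * (v - u) = (\<Sum>x = Suc u..<Suc v. 2)" by simp
  also have "\<dots> \<le> (\<Sum>x = Suc u..<Suc v. line_count n snd D x)"
  proof (rule sum_mono)
    fix x assume "x \<in> {Suc u..<Suc v}"
    then show "2 \<le> line_count n snd D x" using heavy[of "x - 1"] by (cases x) auto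
  qed
  also have "\<dots> \<le> (\<Sum>x = u..<v + 2. line_count n snd C x)"
    by (rule sum_col_count_move[OF D])
  finally show ?thesis .
qed simp

text \<open>
  How far the cops in column \<open>x\<close> that can be in row \<open>t + 1\<close> after their next move may let the
  total number of cops fall below \<open>2n\<close>.  A cop in the row itself weighs more than one in a
  neighboring row because only she can move along the row, and so reach three of its vertices.
\<close>

definition cost :: "nat \<Rightarrow> (nat \<times> nat) list \<Rightarrow> nat \<Rightarrow> nat \<Rightarrow> nat" where
  "cost n C t x =
     5 * line_count n snd (filter (\<lambda>v. fst v = Suc t mod n) C) x +
     4 * line_count n snd (filter (\<lambda>v. fst v = t mod n) C) x +
     4 * line_count n snd (filter (\<lambda>v. fst v = Suc (Suc t) mod n) C) x"

lemma line_count_filter_pos_iff: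
  "line_count n snd (filter (\<lambda>v. fst v = s) C) x > 0 \<longleftrightarrow> (s, x mod n) \<in> set C"
  by (force simp: line_count_def filter_empty_conv)

lemma cost_eq_0_iff:
  "cost n C t x = 0 \<longleftrightarrow> (Suc t mod n, x mod n) \<notin> set C \<and> (t mod n, x mod n) \<notin> set C \<and>
     (Suc (Suc t) mod n, x mod n) \<notin> set C"
  unfolding cost_def line_count_filter_pos_iff[symmetric] by auto

text \<open>
  Between a column \<open>q\<close> with cops close to row \<open>t + 1\<close> and the next such column, the
  unreachable interval starts at \<open>q + 2\<close> if \<open>q\<close> contains a cop of that row, and at \<open>q + 1\<close>
  otherwise.  On the right it ends at \<open>j - 2\<close> in both cases, since a cop in column \<open>j\<close> might be in
  the row.  Enlarging it by one column on either side stays within \<open>q, \<dots>, j - 1\<close>, so that the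
  bounds for consecutive gaps can be added.  In the first case column \<open>q\<close> is not part of the
  enlarged interval; its cop lowers the loss from \<open>6\<close> to \<open>5\<close>.
\<close>

lemma cops_up_to_next_cost:
  assumes n: "n > 0"
    and no_haven: "\<And>x. \<not> haven n C (Suc t mod n, x mod n)"
    and q: "q < j" "cost n C t q > 0" "\<And>x. q < x \<Longrightarrow> x < j \<Longrightarrow> cost n C t x = 0"
  shows "2 * (j - q) \<le> (\<Sum>x = q..<j. line_count n snd C x) + cost n C t q"
proof (cases "(Suc t mod n, q mod n) \<in> set C")
  case True
  have "1 \<le> line_count n snd C q" using line_count_pos[OF True, of snd] by simp
  moreover have "5 \<le> cost n C t q"
    using True line_count_filter_pos_iff[of n "Suc t mod n" C q] unfolding cost_def by linarith
  moreover have "2 * (j - q) \<le> (\<Sum>x = Suc q..<j. line_count n snd C x) + 6"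
  proof (cases "j \<le> q + 3")
    case False
    then have j: "j - 2 + 2 = j" by simp
    have "2 * (j - 2 - Suc q) \<le> (\<Sum>x = Suc q..<j - 2 + 2. line_count n snd C x)"
    proof (rule cops_facing_unreachable_interval[OF n no_haven])
      fix x D assume x: "Suc q \<le> x" "x < j - 2" "cop_move (torus n) C D"
      have "Suc (Suc x) < j" using x(2) by linarith
      with x show "(Suc t mod n, Suc x mod n) \<notin> set D"
        using q(3)[of x] q(3)[of "Suc x"] q(3)[of "Suc (Suc x)"]
        by - (rule not_occupied_next[OF x(3)], auto simp: cost_eq_0_iff)
    qed
    then show ?thesis unfolding j by linarith
  qed simp
  moreover have "(\<Sum>x = q..<j. line_count n snd C x) =
      line_count n snd C q + (\<Sum>x = Suc q..<j. line_count n snd C x)"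
    using q(1) by (rule sum.atLeast_Suc_lessThan)
  ultimately show ?thesis by linarith
next
  case no_cop: False
  have "4 \<le> cost n C t q"
    using q(2) unfolding cost_def by presburger
  moreover have "2 * (j - q) \<le> (\<Sum>x = q..<j. line_count n snd C x) + 4"
  proof (cases "j \<le> q + 2")
    case False
    then have j: "j - 2 + 2 = j" by simp
    have "2 * (j - 2 - q) \<le> (\<Sum>x = q..<j - 2 + 2. line_count n snd C x)"
    proof (rule cops_facing_unreachable_interval[OF n no_haven])
      fix x D assume x: "q \<le> x" "x < j - 2" "cop_move (torus n) C D"
      have "Suc (Suc x) < j" using x(2) by linarith
      have "(Suc t mod n, x mod n) \<notin> set C"
        using no_cop q(3)[of x] x by (cases "x = q") (auto simp: cost_eq_0_iff)
      with x \<open>Suc (Suc x) < j\<close> show "(Suc t mod n, Suc x mod n) \<notin> set D"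
        using q(3)[of "Suc x"] q(3)[of "Suc (Suc x)"]
        by - (rule not_occupied_next[OF x(3)], auto simp: cost_eq_0_iff)
    qed
    then show ?thesis unfolding j by linarith
  qed simp
  ultimately show ?thesis by linarith
qed

lemma cops_up_to:
  assumes n: "n > 0"
    and no_haven: "\<And>x. \<not> haven n C (Suc t mod n, x mod n)"
    and p: "cost n C t p > 0" "p \<le> j"
  shows "2 * (j - p) \<le> (\<Sum>x = p..<j. line_count n snd C x + cost n C t x)"
  using p(2)
proof (induction j rule: less_induct)
  case (less j)
  show ?case
  proof (cases "j = p")
    case False
    let ?Q = "{x. p \<le> x \<and> x < j \<and> cost n C t x > 0}"
    define q where "q = Max ?Q"
    have fin: "finite ?Q" by (rule finite_subset[of _ "{..<j}"]) auto
    have "p \<in> ?Q" using False less.prems p(1) by auto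
    then have "q \<in> ?Q" unfolding q_def using fin by (intro Max_in) auto
    then have q: "p \<le> q" "q < j" "cost n C t q > 0" by auto
    have "cost n C t x = 0" if "q < x" "x < j" for x
    proof (rule ccontr)
      assume "cost n C t x \<noteq> 0"
      with that q have "x \<in> ?Q" by auto
      with fin have "x \<le> q" unfolding q_def by (intro Max_ge)
      with that show False by simp
    qed
    then have "2 * (j - q) \<le> (\<Sum>x = q..<j. line_count n snd C x) + cost n C t q"
      using q by (intro cops_up_to_next_cost[OF n no_haven])
    also have "\<dots> \<le> (\<Sum>x = q..<j. line_count n snd C x) + (\<Sum>x = q..<j. cost n C t x)"
      using q member_le_sum[of q "{q..<j}" "cost n C t"] by simp
    finally have "2 * (j - q) \<le> (\<Sum>x = q..<j. line_count n snd C x + cost n C t x)"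
      by (simp add: sum.distrib)
    moreover have "2 * (q - p) \<le> (\<Sum>x = p..<q. line_count n snd C x + cost n C t x)"
      using less.IH[of q] q by simp
    moreover have "(\<Sum>x = p..<j. line_count n snd C x + cost n C t x) =
        (\<Sum>x = p..<q. line_count n snd C x + cost n C t x) +
        (\<Sum>x = q..<j. line_count n snd C x + cost n C t x)"
      using q by (intro sum.atLeastLessThan_concat[symmetric]) auto
    ultimately show ?thesis using q by linarith
  qed simp
qed

text \<open>
  One full turn around the torus, starting at a column of positive cost.  If there is none, then
  no cop can enter row \<open>t + 1\<close>, which is thus light and consists of havens.
\<close>

lemma row_without_haven:
  assumes n: "n > 0" and C: "set C \<subseteq> pverts (torus n)"
    and no_haven: "\<And>x. \<not> haven n C (Suc t mod n, x mod n)"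
  shows "2 * n \<le> length C + 5 * line_count n fst C (Suc t) + 4 * line_count n fst C t
    + 4 * line_count n fst C (Suc (Suc t))"
proof (cases "\<exists>p. cost n C t p > 0")
  case True
  then obtain p where p: "cost n C t p > 0" by blast
  have col: "(\<Sum>x = p..<p + n. line_count n snd (filter P C) x) = length (filter P C)" for P
    using C by (intro sum_line_count) (auto simp: pverts_torus)
  have "2 * n \<le> (\<Sum>x = p..<p + n. line_count n snd C x + cost n C t x)"
    using cops_up_to[OF n no_haven p, of "p + n"] by simp
  also have "\<dots> = length C + 5 * line_count n fst C (Suc t) + 4 * line_count n fst C t
    + 4 * line_count n fst C (Suc (Suc t))"
    unfolding cost_def sum.distrib sum_distrib_left[symmetric] col
    using col[of "\<lambda>_. True"] by (simp add: line_count_def)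
  finally show ?thesis .
next
  case False
  have "haven n C (Suc t mod n, 0 mod n)"
    unfolding haven_def
  proof (intro conjI allI impI)
    fix D assume D: "cop_move (torus n) C D"
    have empty: "(Suc t mod n, Suc x mod n) \<notin> set D" for x
      using False by - (rule not_occupied_next[OF D], auto simp: cost_eq_0_iff)
    have row: "(Suc t mod n, x) \<notin> set D" for x
    proof
      assume *: "(Suc t mod n, x) \<in> set D"
      then have "x < n" using cop_move_pverts[OF D C] by (auto simp: pverts_torus)
      with * empty[of "x + n - 1"] n show False by simp
    qed
    then show "(Suc t mod n, 0 mod n) \<notin> set D" by blast
    have "line_count n fst D (Suc t mod n) = 0"
      using row by (auto simp: line_count_def filter_empty_conv)
    then have "on_light_line n D (Suc t mod n, 0 mod n)"
      by (simp add: on_light_line_def)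
    with row n show "\<exists>s \<in> pverts (torus n). s \<notin> set D \<and> on_light_line n D s \<and>
        linked n D (Suc t mod n, 0 mod n) s"
      by (intro bexI[of _ "(Suc t mod n, 0 mod n)"]) (auto simp: pverts_torus)
  qed (use n in \<open>simp add: pverts_torus\<close>)
  with no_haven show ?thesis by blast
qed

text \<open>
  The counts are integers, which gives more than averaging \<open>25 \<le> 5b + 4a + 4c\<close> over all rows:
  that would only give \<open>25/13\<close> cops per row, less than two.  The two neighboring windows of three
  rows have sum at least \<open>12\<close>, because a window of sum \<open>5\<close> has all its cops in the middle row,
  and then the other one has sum at least \<open>7\<close>; smaller sums are impossible.
\<close>

lemma two_heavy_rows:
  fixes a b c d :: nat
  assumes "25 \<le> 5 * b + 4 * a + 4 * c" "25 \<le> 5 * c + 4 * b + 4 * d"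
  shows "12 \<le> a + 2 * b + 2 * c + d"
proof -
  consider "a + b + c \<le> 5" | "b + c + d \<le> 5" | "6 \<le> a + b + c" "6 \<le> b + c + d"
    by linarith
  then show ?thesis
  proof cases
    case 1
    then have "b = 5" "c = 0" using assms(1) by linarith+
    then have "2 \<le> d" using assms(2) by simp
    with \<open>b = 5\<close> show ?thesis by simp
  next
    case 2
    then have "c = 5" "b = 0" using assms(2) by linarith+
    then have "2 \<le> a" using assms(1) by simp
    with \<open>c = 5\<close> show ?thesis by simp
  qed linarith
qed

lemma haven_exists:
  assumes C: "set C \<subseteq> pverts (torus n)" and few: "length C + 25 \<le> 2 * n"
  shows "\<exists>r. haven n C r"
proof (rule ccontr)
  assume "\<nexists>r. haven n C r"
  then have no_haven: "\<And>r. \<not> haven n C r" by blast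
  have n: "n > 0" using few by simp
  define a where "a = line_count n fst C"
  have row: "25 \<le> 5 * a (Suc t) + 4 * a t + 4 * a (Suc (Suc t))" for t
    using row_without_haven[OF n C no_haven, of t] few by (simp add: a_def)
  have window: "12 \<le> a (t + 0) + 2 * a (t + 1) + 2 * a (t + 2) + a (t + 3)" for t
    using two_heavy_rows[OF row[of t] row[of "Suc t"]] by (simp add: numeral_3_eq_3)
  have total: "(\<Sum>t = 0..<n. a (t + i)) = length C" for i
  proof -
    have "(\<Sum>t = 0..<n. a (t + i)) = (\<Sum>t = i..<i + n. a t)"
      using sum.shift_bounds_nat_ivl[of a 0 i n] by (simp add: add.commute)
    also have "\<dots> = length C"
      unfolding a_def using C by (intro sum_line_count) (auto simp: pverts_torus)
    finally show ?thesis .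
  qed
  have "12 * n = (\<Sum>t = 0..<n. 12)" by simp
  also have "\<dots> \<le> (\<Sum>t = 0..<n. a (t + 0) + 2 * a (t + 1) + 2 * a (t + 2) + a (t + 3))"
    by (intro sum_mono window)
  also have "\<dots> = 6 * length C"
    unfolding sum.distrib sum_distrib_left[symmetric] total by simp
  finally show False using few by simp
qed

section \<open>The robber evades fewer than 2n - 24 cops\<close>

lemma robber_move_between_havens:
  assumes C: "set C \<subseteq> pverts (torus n)" and few: "length C + 5 \<le> 2 * n"
    and move: "cop_move (torus n) C D" and r: "haven n C r" and r': "haven n D r'"
  shows "robber_move (torus n) D r r'"
proof -
  have stay: "cop_move (torus n) D D" by (simp add: cop_move_def list_all2_refl)
  have "length D = length C" using move by (auto simp: cop_move_def dest: list_all2_lengthD)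
  then have D: "set D \<subseteq> pverts (torus n)" "length D + 5 \<le> 2 * n"
    using cop_move_pverts[OF move C] few by auto
  obtain s where s: "s \<in> pverts (torus n)" "s \<notin> set D" "on_light_line n D s" "linked n D r s"
    using r move unfolding haven_def by blast
  obtain s' where s': "s' \<in> pverts (torus n)" "s' \<notin> set D" "on_light_line n D s'" "linked n D r' s'"
    using r' stay unfolding haven_def by blast
  have "linked n D s s'"
    using linked_if_on_light_lines[OF D s(1-3) s'(1-3)] .
  with s(4) linked_sym[OF s'(4)] have "linked n D r r'"
    by (meson rtranclp_trans)
  then show ?thesis by (rule robber_move_if_linked)
qed

lemma robber_evades_few_cops:
  assumes few: "k + 25 \<le> 2 * n"
  shows "\<not> cops_win (torus n) k"
proof
  assume "cops_win (torus n) k"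
  then obtain S where S: "cop_strategy (torus n) k S"
    and win: "\<And>r. robber_play (torus n) S r \<Longrightarrow> captured S r"
    unfolding cops_win_def by blast
  \<comment> \<open>The robber chooses a haven for the configuration that answers his past positions.\<close>
  define pick where "pick h = (SOME r. haven n (S h) r)" for h
  define H where "H = rec_nat [] (\<lambda>_ h. h @ [pick h])"
  define r where "r i = pick (H i)" for i
  have H_Suc: "H (Suc i) = H i @ [r i]" for i by (simp add: H_def r_def)
  have H: "H i = map r [0..<i]" for i
    by (induction i) (simp_all add: H_Suc, simp add: H_def)
  have conf: "length (S h) = k" "set (S h) \<subseteq> pverts (torus n)" if "set h \<subseteq> pverts (torus n)" for h
    using S that unfolding cop_strategy_def by auto
  have pick: "haven n (S h) (pick h)" if "set h \<subseteq> pverts (torus n)" for h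
    unfolding pick_def by (rule someI_ex, rule haven_exists) (use conf[OF that] few in simp_all)
  have inV: "set (H i) \<subseteq> pverts (torus n)" for i
  proof (induction i)
    case (Suc i)
    have "r i \<in> pverts (torus n)"
      using pick[OF Suc] unfolding r_def haven_def by (rule conjunct1)
    with Suc show ?case by (simp add: H_Suc)
  qed (simp add: H_def)
  have hav: "haven n (S (H i)) (r i)" for i unfolding r_def by (rule pick[OF inV])
  have move: "cop_move (torus n) (S (H i)) (S (H (Suc i)))" for i
  proof -
    have "r i \<in> pverts (torus n)" using hav unfolding haven_def by (rule conjunct1)
    with S inV[of i] show ?thesis unfolding cop_strategy_def H_Suc by blast
  qed
  have "robber_play (torus n) S r"
    unfolding robber_play_def H[symmetric]
  proof (intro conjI allI)
    show "r i \<in> pverts (torus n)" for i using hav by (simp add: haven_def)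
    show "robber_move (torus n) (S (H (Suc i))) (r i) (r (Suc i))" for i
      using conf[OF inV, of i] few hav move
      by (intro robber_move_between_havens[of "S (H i)"]) auto
  qed
  then have "captured S r" by (rule win)
  then obtain i where i: "r i \<in> set (S (H i)) \<or> r i \<in> set (S (H (Suc i)))"
    unfolding captured_def H[symmetric] by blast
  have avoids: "r i \<notin> set D" if "cop_move (torus n) (S (H i)) D" for D
    using hav[of i] that unfolding haven_def by blast
  have "cop_move (torus n) (S (H i)) (S (H i))"
    by (simp add: cop_move_def list_all2_refl)
  from avoids[OF this] avoids[OF move] i show False by blast
qed

section \<open>Two walls of cops catch the robber\<close>

text \<open>
  The walls are row \<open>0\<close> and row \<open>m\<close>; since a step changes the row by at most one, a path that
  starts beyond row \<open>m\<close> can leave the rows beyond \<open>m\<close> only through one of them.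
\<close>

lemma vpath_between_walls:
  assumes "vpath p (with_proj (torus n))"
    and walls: "\<And>x. x < n \<Longrightarrow> (0, x) \<notin> set p" "\<And>x. x < n \<Longrightarrow> (m, x) \<notin> set p"
    and "m < fst (hd p)"
  shows "m < fst (last p)"
proof -
  have "vwalk p (with_proj (torus n))" using assms(1) by blast
  then show ?thesis using walls assms(4)
  proof (induction p rule: vwalk_induct)
    case (Cons u v es)
    obtain a b c d where uv: "u = (a, b)" "v = (c, d)" by (cases u, cases v)
    have arc: "((a, b), (c, d)) \<in> parcs (torus n)"
      using Cons.hyps(1) by (auto simp: uv arcs_ends_def arc_to_ends_def)
    have "c \<noteq> 0" "c \<noteq> m"
      using arc Cons.prems(1,2)[of d] by (auto simp: uv parcs_torus)
    have "m < a" using Cons.prems(3) by (simp add: uv)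
    have wrap: "Suc e mod n = (if Suc e = n then 0 else Suc e)" if "e < n" for e
      using that by (simp add: mod_Suc)
    have "a < n" "c < n" "c = a \<or> c = Suc a mod n \<or> a = Suc c mod n"
      using arc unfolding parcs_torus by blast+
    then have "c = a \<or> c = Suc a \<or> a = Suc c \<or> c = 0 \<or> a = 0"
      using wrap[of a] wrap[of c] by metis
    with \<open>c \<noteq> 0\<close> \<open>c \<noteq> m\<close> \<open>m < a\<close> have "m < c" by linarith
    then show ?case using Cons.IH Cons.prems by (simp add: uv)
  qed simp
qed

lemma two_walls_win:
  assumes n: "n > 0"
  shows "cops_win (torus n) (2 * n)"
proof -
  define wall where "wall i = map (\<lambda>x. (i mod n, x)) [0..<n]" for i
  define S :: "(nat \<times> nat) list \<Rightarrow> (nat \<times> nat) list" where "S h = wall 0 @ wall (length h)" for h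
  have set_S: "set (S h) = {0, length h mod n} \<times> {0..<n}" for h
    by (auto simp: S_def wall_def)
  have "cop_strategy (torus n) (2 * n) S"
    unfolding cop_strategy_def
  proof (intro conjI allI impI)
    show "length (S h) = 2 * n" for h by (simp add: S_def wall_def)
    show "set (S h) \<subseteq> pverts (torus n)" for h
      using n by (auto simp: set_S pverts_torus)
    fix h :: "(nat \<times> nat) list" and r :: "nat \<times> nat"
    let ?step = "\<lambda>u v. u = v \<or> (u, v) \<in> parcs (torus n)"
    have "((i mod n, x), (Suc i mod n, x)) \<in> parcs (torus n)" if "x < n" for i x
      using that n unfolding parcs_torus by (simp add: mod_Suc_eq)
    then have "list_all2 ?step (wall i) (wall (Suc i))" for i
      unfolding wall_def list_all2_map1 list_all2_map2 by (intro list.rel_refl_strong) simp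
    then have "list_all2 ?step (wall 0 @ wall (length h)) (wall 0 @ wall (Suc (length h)))"
      by (intro list_all2_appendI list_all2_refl) simp_all
    then show "cop_move (torus n) (S h) (S (h @ [r]))"
      by (simp add: cop_move_def S_def)
  qed
  moreover have "captured S r" if play: "robber_play (torus n) S r" for r
  proof (rule ccontr)
    assume "\<not> captured S r"
    have walls: "set (S (map r [0..<i])) = {0, i mod n} \<times> {0..<n}" for i
      unfolding set_S by simp
    from \<open>\<not> captured S r\<close>
    have safe: "r i \<notin> {0, i mod n} \<times> {0..<n}" "r i \<notin> {0, Suc i mod n} \<times> {0..<n}" for i
      unfolding captured_def walls by metis+
    have inV: "r i \<in> {0..<n} \<times> {0..<n}" for i
      using play by (simp add: robber_play_def pverts_torus)
    have move: "robber_move (torus n) (S (map r [0..<Suc i])) (r i) (r (Suc i))" for i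
      using play by (simp add: robber_play_def)
    have "i < fst (r i)" if "i < n" for i
      using that
    proof (induction i)
      case 0
      then show ?case using safe(1)[of 0] inV[of 0] by (cases "r 0") auto
    next
      case (Suc i)
      then have "i < fst (r i)" by simp
      moreover have "fst (r i) \<noteq> Suc i"
        using safe(2)[of i] inV[of i] Suc.prems by (cases "r i") auto
      ultimately have beyond: "Suc i < fst (r i)" by simp
      from move[of i] show ?case
        unfolding robber_move_def
      proof (elim disjE exE conjE)
        fix p assume p: "vpath p (with_proj (torus n))" "hd p = r i" "last p = r (Suc i)"
          "set p \<inter> set (S (map r [0..<Suc i])) = {}"
        have off: "(s, x) \<notin> set p" if "x < n" "s = 0 \<or> s = Suc i mod n" for s x
          using p(4) that unfolding walls by auto
        show ?thesis
          using vpath_between_walls[OF p(1), of "Suc i"] off beyond p(2,3) Suc.prems by simp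
      qed (use beyond in simp)
    qed
    from this[of "n - 1"] inV[of "n - 1"] n show False by (cases "r (n - 1)") auto
  qed
  ultimately show ?thesis unfolding cops_win_def by blast
qed

theorem theorem2p7:
  fixes n :: nat
  assumes "n \<ge> 18"
  shows "2 * n - 24 \<le> c\<^sub>\<infinity> (cycle_graph n \<box> cycle_graph n)
       \<and> c\<^sub>\<infinity> (cycle_graph n \<box> cycle_graph n) \<le> 2 * n"
proof
  have "cops_win (torus n) (c\<^sub>\<infinity> (torus n))"
    by (rule cops_win_cop_number_infinity) (simp add: pverts_torus)
  then have "\<not> c\<^sub>\<infinity> (torus n) + 25 \<le> 2 * n"
    using robber_evades_few_cops by blast
  then show "2 * n - 24 \<le> c\<^sub>\<infinity> (torus n)" by simp
  show "c\<^sub>\<infinity> (torus n) \<le> 2 * n"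
    unfolding cop_number_infinity_def
    using assms by (intro Least_le two_walls_win) simp
qed

end
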